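(* Let $f$ and $w$ be two real-valued functions defined on $[a,b]\times[c,d]$ that fulfill the following two conditions: (i) $f$ is continuously differentiable and $2d$-monotone decreasing; (ii) $w$ is integrable and $W(x,y)=\int_{a}^{x}\int_{c}^{y}w(s,t)\,dt\,ds\geq 0$ for all $(x,y)\in[a,b]\times[c,d]$. Then $$\int_{a}^{b}\int_{c}^{d}f(x,y)w(x,y)\,dy\,dx\geq f(b,d)\,W(b,d).$$
   Context: Here $[a,b]$ and $[c,d]$ are compact intervals in $\mathbb{R}$. A function $f:I\times J\to\mathbb{R}$ ($I,J$ intervals) is called $2d$-monotone if for every compact subinterval $[a',b']\times[c',d']\subset I\times J$ one has $$f(a',c')-f(a',d')-f(b',c')+f(b',d')\geq 0.$$ It is called $2d$-monotone decreasing if it is $2d$-monotone and also decreasing (in the weak sense) in each variable when the other variable is kept fixed. *)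

theory Defs
  imports "HOL-Analysis.Analysis"
begin

definition two_d_monotone :: "real set \<Rightarrow> real set \<Rightarrow> (real \<times> real \<Rightarrow> real) \<Rightarrow> bool"
  where "two_d_monotone I J f \<longleftrightarrow>
    (\<forall>a' b' c' d'. a' \<le> b' \<and> c' \<le> d' \<and> {a'..b'} \<times> {c'..d'} \<subseteq> I \<times> J \<longrightarrow>
       f (a', c') - f (a', d') - f (b', c') + f (b', d') \<ge> 0)"

definition two_d_monotone_decreasing :: "real set \<Rightarrow> real set \<Rightarrow> (real \<times> real \<Rightarrow> real) \<Rightarrow> bool"
  where "two_d_monotone_decreasing I J f \<longleftrightarrow>
    two_d_monotone I J f \<and>
    (\<forall>y\<in>J. antimono_on I (\<lambda>x. f (x, y))) \<and>
    (\<forall>x\<in>I. antimono_on J (\<lambda>y. f (x, y)))"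

text \<open>The derivative is taken within \<open>S\<close>, so at boundary points of a closed rectangle it is
  one-sided; continuity of the derivative is with respect to the operator norm.\<close>

definition continuously_differentiable_on :: "(real \<times> real \<Rightarrow> real) \<Rightarrow> (real \<times> real) set \<Rightarrow> bool"
    (infix "continuously'_differentiable'_on" 50)
  where "f continuously_differentiable_on S \<longleftrightarrow>
    (\<exists>f' :: real \<times> real \<Rightarrow> (real \<times> real) \<Rightarrow>\<^sub>L real.
       (\<forall>z\<in>S. (f has_derivative blinfun_apply (f' z)) (at z within S)) \<and>
       continuous_on S f')"

text \<open>Integrals are with respect to the completed measure \<^const>\<open>lebesgue\<close>, so that weights that
  are Lebesgue (for instance Riemann) integrable but not Borel measurable are included.\<close>

definition double_primitive :: "real \<Rightarrow> real \<Rightarrow> (real \<times> real \<Rightarrow> real) \<Rightarrow> real \<Rightarrow> real \<Rightarrow> real"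
  where "double_primitive a c w x y =
    (LINT s:{a..x}|lebesgue. (LINT t:{c..y}|lebesgue. w (s, t)))"

end

theory Submission
  imports Defs
begin

text \<open>
  Writing \<open>f (x, y)\<close> as \<open>f (b, d)\<close> plus its increments towards the corner \<open>(b, d)\<close> exhibits \<open>f\<close>, up to
  the constant \<open>f (b, d)\<close>, as a limit of nonnegative combinations of indicators of lower-left
  rectangles: the one-dimensional increments along the edges \<open>x = b\<close> and \<open>y = d\<close> are nonnegative as \<open>f\<close>
  decreases, the mixed increments as \<open>f\<close> is 2d-monotone. The integral of \<open>w\<close> over such a rectangle is a value
  of \<open>W\<close>, hence nonnegative. Dominated convergence over uniform grids gives the claim.
\<close>

section \<open>Fubini for the completed Lebesgue measure\<close>

text \<open>Measurability of \<open>g\<close> comes from completeness, since \<open>g\<close> agrees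
  almost everywhere with the Borel function \<open>u\<close>. Hence the lemma also applies to inner
  integrals, whose measurability in the outer variable is not known beforehand.\<close>

lemma integral_lebesgue_eq_lborel:
  fixes g u :: "'a::euclidean_space \<Rightarrow> real"
  assumes u: "u \<in> borel_measurable lborel" and eq: "AE x in lborel. g x = u x"
  shows "(LINT x|lebesgue. g x) = (LINT x|lborel. u x)"
proof -
  have u': "u \<in> borel_measurable lebesgue"
    using u by (rule measurable_completion)
  have eq': "AE x in lebesgue. u x = g x"
    using AE_completion[OF eq] by eventually_elim simp
  have "g \<in> borel_measurable lebesgue"
    using borel_measurable_AE[OF u' eq'] .
  then have "(LINT x|lebesgue. g x) = (LINT x|lebesgue. u x)"
    using u' eq' by (intro integral_cong_AE) (auto elim: eventually_mono)
  also have "\<dots> = (LINT x|lborel. u x)"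
    using u by (rule integral_completion)
  finally show ?thesis .
qed

text \<open>Sections of \<open>h\<close> can fail to be measurable for a null set of
  \<open>x\<close>, so Fubini is applied to a Borel version \<open>u\<close>. Almost every section
  of the null set where \<open>h\<close> and \<open>u\<close> differ is null, so the inner integrals
  agree for almost every \<open>x\<close>.\<close>

lemma iterated_integral_lebesgue:
  fixes h :: "'a::euclidean_space \<times> 'b::euclidean_space \<Rightarrow> real"
  assumes h: "integrable lebesgue h"
  shows "(LINT x|lebesgue. LINT y|lebesgue. h (x, y)) = (LINT z|lebesgue. h z)"
proof -
  obtain u where u[measurable]: "u \<in> borel_measurable lborel" and eq: "AE z in lborel. h z = u z"
    using completion_ex_borel_measurable_real[OF borel_measurable_integrable[OF h]] by auto
  have u2: "u \<in> borel_measurable (lborel \<Otimes>\<^sub>M lborel)"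
    using u by (simp add: lborel_prod)
  have "integrable lebesgue u"
    by (rule integrable_cong_AE_imp[OF h])
       (use u eq in \<open>auto intro: measurable_completion AE_completion\<close>)
  then have int: "integrable (lborel \<Otimes>\<^sub>M lborel) u"
    using u by (simp add: integrable_completion lborel_prod)
  have "AE x in lborel. AE y in lborel. h (x, y) = u (x, y)"
    by (rule lborel_pair.AE_pair) (subst lborel_prod, rule eq)
  then have "AE x in lborel. (LINT y|lebesgue. h (x, y)) = (LINT y|lborel. u (x, y))"
  proof eventually_elim
    case (elim x)
    show ?case
      by (rule integral_lebesgue_eq_lborel[OF _ elim]) (use u2 in simp)
  qed
  then have "(LINT x|lebesgue. LINT y|lebesgue. h (x, y)) = (LINT x|lborel. LINT y|lborel. u (x, y))"
    by (intro integral_lebesgue_eq_lborel) (use lborel_pair.integrable_fst'[OF int] in simp)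
  also have "\<dots> = (LINT z|lborel. u z)"
    using lborel_pair.integral_fst'[OF int] by (simp add: lborel_prod)
  also have "\<dots> = (LINT z|lebesgue. h z)"
    using integral_lebesgue_eq_lborel[OF u eq] by simp
  finally show ?thesis .
qed

lemma iterated_set_integral_lebesgue:
  fixes h :: "'a::euclidean_space \<times> 'b::euclidean_space \<Rightarrow> real"
  assumes "set_integrable lebesgue (A \<times> B) h"
  shows "(LINT x:A|lebesgue. (LINT y:B|lebesgue. h (x, y))) = (LINT z:A \<times> B|lebesgue. h z)"
proof -
  have "(LINT x:A|lebesgue. (LINT y:B|lebesgue. h (x, y))) =
    (LINT x|lebesgue. LINT y|lebesgue. indicator (A \<times> B) (x, y) * h (x, y))"
    unfolding set_lebesgue_integral_def
    by (simp add: indicator_times mult.assoc)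
  also have "\<dots> = (LINT z:A \<times> B|lebesgue. h z)"
    using iterated_integral_lebesgue[OF assms[unfolded set_integrable_def]]
    by (simp add: set_lebesgue_integral_def)
  finally show ?thesis .
qed

section \<open>Step functions as combinations of quadrant indicators\<close>

text \<open>The condition \<open>x \<le> X i\<close> holds exactly from the least such index
  \<open>k\<close> on, so the sum telescopes to \<open>g (X k) - g (X n)\<close>. The quantifier
  over \<open>g\<close> stands inside because one \<open>k\<close> has to serve
  \<open>f (_, y)\<close> for every grid value of \<open>y\<close>.\<close>

lemma mono_grid_expansion:
  fixes X :: "nat \<Rightarrow> real" and g :: "real \<Rightarrow> real"
  assumes "mono X" and "x \<le> X n"
  obtains k where "k \<le> n" "x \<le> X k" "k = 0 \<or> X (k - 1) < x"
    "\<forall>g. g (X n) + (\<Sum>i<n. of_bool (x \<le> X i) * (g (X i) - g (X (Suc i)))) = (g (X k) :: real)"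
proof -
  define k where "k = (LEAST k. x \<le> X k)"
  have k: "x \<le> X k" "k \<le> n"
    using assms(2) unfolding k_def by (auto intro: LeastI Least_le)
  have less: "X i < x" if "i < k" for i
    using not_less_Least[of i "\<lambda>k. x \<le> X k"] that by (auto simp: k_def)
  have ge: "x \<le> X i" if "k \<le> i" for i
    using k monoD[OF assms(1) that] by simp
  have "g (X n) + (\<Sum>i<n. of_bool (x \<le> X i) * (g (X i) - g (X (Suc i)))) = (g (X k) :: real)" for g
  proof -
    have "(\<Sum>i<n. of_bool (x \<le> X i) * (g (X i) - g (X (Suc i)))) =
      (\<Sum>i=k..<n. g (X i) - g (X (Suc i)))"
      using less ge by (intro sum.mono_neutral_cong_right) (auto simp: not_le)
    also have "\<dots> = g (X k) - g (X n)"
      using sum_Suc_diff'[OF \<open>k \<le> n\<close>, of "\<lambda>i. - g (X i)"] by simp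
    finally show ?thesis by simp
  qed
  with k less that[of k] show ?thesis
    by (metis diff_less gr0I zero_less_one)
qed

text \<open>By Abel summation this is the step function \<open>f (X k, Y l)\<close>, where \<open>X k\<close> and \<open>Y l\<close> are the
  first grid points above the coordinates of \<open>z\<close>.\<close>

definition rect_step ::
  "(real \<times> real \<Rightarrow> real) \<Rightarrow> (nat \<Rightarrow> real) \<Rightarrow> (nat \<Rightarrow> real) \<Rightarrow> nat \<Rightarrow> real \<times> real \<Rightarrow> real"
  where "rect_step f X Y n z = f (X n, Y n)
    + (\<Sum>i<n. indicator ({..X i} \<times> {..Y n}) z * (f (X i, Y n) - f (X (Suc i), Y n)))
    + (\<Sum>j<n. indicator ({..X n} \<times> {..Y j}) z * (f (X n, Y j) - f (X n, Y (Suc j))))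
    + (\<Sum>j<n. \<Sum>i<n. indicator ({..X i} \<times> {..Y j}) z *
        (f (X i, Y j) - f (X i, Y (Suc j)) - f (X (Suc i), Y j) + f (X (Suc i), Y (Suc j))))"

text \<open>The indicators factor into a weight \<open>p i\<close> in \<open>x\<close> and a weight
  \<open>q j\<close> in \<open>y\<close>, so the one-dimensional expansion can be applied first in
  \<open>x\<close> with the second coordinate frozen and then in \<open>y\<close>.\<close>

lemma rect_step_eq:
  assumes "mono X" "mono Y" "x \<le> X n" "y \<le> Y n"
  obtains k l where "k \<le> n" "x \<le> X k" "k = 0 \<or> X (k - 1) < x"
    "l \<le> n" "y \<le> Y l" "l = 0 \<or> Y (l - 1) < y"
    "rect_step f X Y n (x, y) = f (X k, Y l)"
proof -
  obtain k where k: "k \<le> n" "x \<le> X k" "k = 0 \<or> X (k - 1) < x"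
    and X: "\<forall>g. g (X n) + (\<Sum>i<n. of_bool (x \<le> X i) * (g (X i) - g (X (Suc i)))) = (g (X k) :: real)"
    by (rule mono_grid_expansion[OF assms(1,3)])
  obtain l where l: "l \<le> n" "y \<le> Y l" "l = 0 \<or> Y (l - 1) < y"
    and Y: "\<forall>g. g (Y n) + (\<Sum>i<n. of_bool (y \<le> Y i) * (g (Y i) - g (Y (Suc i)))) = (g (Y l) :: real)"
    by (rule mono_grid_expansion[OF assms(2,4)])
  define p q :: "nat \<Rightarrow> real" where "p i = of_bool (x \<le> X i)" and "q j = of_bool (y \<le> Y j)" for i j
  have ind: "indicator ({..X i} \<times> {..Y j}) (x, y) = p i * q j" for i j
    by (simp add: p_def q_def indicator_def)
  \<comment> \<open>This reduces the weights of the edge terms to \<open>p i\<close> and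
    \<open>q j\<close> alone.\<close>
  have pq: "p n = 1" "q n = 1"
    using assms(3,4) by (simp_all add: p_def q_def)
  \<comment> \<open>For each \<open>j\<close>, the edge term on \<open>x = X n\<close> joins the
    mixed terms to form the difference of two full expansions in \<open>x\<close>, at heights
    \<open>Y j\<close> and \<open>Y (Suc j)\<close>.\<close>
  have col: "q j * (f (X n, Y j) - f (X n, Y (Suc j))) + (\<Sum>i<n. p i * q j *
        (f (X i, Y j) - f (X i, Y (Suc j)) - f (X (Suc i), Y j) + f (X (Suc i), Y (Suc j)))) =
      q j * ((f (X n, Y j) + (\<Sum>i<n. p i * (f (X i, Y j) - f (X (Suc i), Y j))))
        - (f (X n, Y (Suc j)) + (\<Sum>i<n. p i * (f (X i, Y (Suc j)) - f (X (Suc i), Y (Suc j))))))" for j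
    by (simp add: sum_distrib_left sum_subtractf sum.distrib algebra_simps)
  have "rect_step f X Y n (x, y) =
    (f (X n, Y n) + (\<Sum>i<n. p i * (f (X i, Y n) - f (X (Suc i), Y n))))
    + (\<Sum>j<n. q j * ((f (X n, Y j) + (\<Sum>i<n. p i * (f (X i, Y j) - f (X (Suc i), Y j))))
        - (f (X n, Y (Suc j)) + (\<Sum>i<n. p i * (f (X i, Y (Suc j)) - f (X (Suc i), Y (Suc j)))))))"
    unfolding rect_step_def ind pq col[symmetric] sum.distrib by simp
  also have "\<dots> = f (X k, Y n) + (\<Sum>j<n. q j * (f (X k, Y j) - f (X k, Y (Suc j))))"
    by (simp only: p_def X[rule_format, of "\<lambda>x. f (x, _)"])
  also have "\<dots> = f (X k, Y l)"
    using Y[rule_format, of "\<lambda>y. f (X k, y)"] by (simp only: q_def)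
  finally show ?thesis
    using that k l by blast
qed

text \<open>Integrating term by term leaves \<open>f (b, d)\<close> times the total integral plus
  products of two nonnegative factors: an increment of \<open>f\<close> and an integral of
  \<open>h\<close> over a quadrant. Quadrants can stand in for rectangles with corner
  \<open>(a, c)\<close> once \<open>h\<close> is a weight extended by zero.\<close>

lemma rect_step_integral_ge:
  assumes X: "mono X" "X 0 = a" "X n = b" and Y: "mono Y" "Y 0 = c" "Y n = d"
    and f: "two_d_monotone_decreasing {a..b} {c..d} f"
    and h: "integrable lebesgue h"
    and nonneg: "\<And>x y. x \<in> {a..b} \<Longrightarrow> y \<in> {c..d} \<Longrightarrow> 0 \<le> (LINT z:{..x} \<times> {..y}|lebesgue. h z)"
  shows "integrable lebesgue (\<lambda>z. rect_step f X Y n z * h z)"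
    and "f (b, d) * (LINT z|lebesgue. h z) \<le> (LINT z|lebesgue. rect_step f X Y n z * h z)"
proof -
  have Xi: "X i \<in> {a..b}" if "i \<le> n" for i
    using X that monoD[OF X(1), of 0 i] monoD[OF X(1), of i n] by auto
  have Yi: "Y i \<in> {c..d}" if "i \<le> n" for i
    using Y that monoD[OF Y(1), of 0 i] monoD[OF Y(1), of i n] by auto
  have int: "integrable lebesgue (\<lambda>z. indicator ({..x} \<times> {..y}) z * h z)" for x y
    using integrable_mult_indicator[OF _ h, of "{..x} \<times> {..y}"]
    by (simp add: borel_Times sets_completionI_sets)
  have expand: "rect_step f X Y n z * h z = f (b, d) * h z
    + (\<Sum>i<n. (f (X i, d) - f (X (Suc i), d)) * (indicator ({..X i} \<times> {..d}) z * h z))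
    + (\<Sum>j<n. (f (b, Y j) - f (b, Y (Suc j))) * (indicator ({..b} \<times> {..Y j}) z * h z))
    + (\<Sum>j<n. \<Sum>i<n. (f (X i, Y j) - f (X i, Y (Suc j)) - f (X (Suc i), Y j) + f (X (Suc i), Y (Suc j)))
        * (indicator ({..X i} \<times> {..Y j}) z * h z))" for z
    unfolding rect_step_def X(3) Y(3)
    by (simp only: distrib_left distrib_right sum_distrib_left sum_distrib_right mult.assoc mult.commute mult.left_commute)
  show "integrable lebesgue (\<lambda>z. rect_step f X Y n z * h z)"
    unfolding expand using h int by simp
  have D1: "0 \<le> f (X i, d) - f (X (Suc i), d)" if "i < n" for i
  proof -
    have "antimono_on {a..b} (\<lambda>x. f (x, d))"
      using f Yi[of n] Y(3) by (auto simp: two_d_monotone_decreasing_def)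
    from monotone_onD[OF this, of "X i" "X (Suc i)"] show ?thesis
      using Xi[of i] Xi[of "Suc i"] monoD[OF X(1), of i "Suc i"] that by simp
  qed
  have D2: "0 \<le> f (b, Y j) - f (b, Y (Suc j))" if "j < n" for j
  proof -
    have "antimono_on {c..d} (\<lambda>y. f (b, y))"
      using f Xi[of n] X(3) by (auto simp: two_d_monotone_decreasing_def)
    from monotone_onD[OF this, of "Y j" "Y (Suc j)"] show ?thesis
      using Yi[of j] Yi[of "Suc j"] monoD[OF Y(1), of j "Suc j"] that by simp
  qed
  have D12: "0 \<le> f (X i, Y j) - f (X i, Y (Suc j)) - f (X (Suc i), Y j) + f (X (Suc i), Y (Suc j))"
    if "i < n" "j < n" for i j
  proof -
    have "{X i..X (Suc i)} \<times> {Y j..Y (Suc j)} \<subseteq> {a..b} \<times> {c..d}"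
      using Xi[of i] Xi[of "Suc i"] Yi[of j] Yi[of "Suc j"] that by auto
    with f show ?thesis
      using monoD[OF X(1), of i "Suc i"] monoD[OF Y(1), of j "Suc j"]
      by (auto simp: two_d_monotone_decreasing_def two_d_monotone_def)
  qed
  have V: "0 \<le> (LINT z|lebesgue. indicator ({..x} \<times> {..y}) z * h z)"
    if "x \<in> {a..b}" "y \<in> {c..d}" for x y
    using nonneg[OF that] by (simp add: set_lebesgue_integral_def)
  have b: "b \<in> {a..b}" and d: "d \<in> {c..d}"
    using Xi[of n] Yi[of n] X(3) Y(3) by auto
  have "(LINT z|lebesgue. rect_step f X Y n z * h z) = f (b, d) * (LINT z|lebesgue. h z)
    + (\<Sum>i<n. (f (X i, d) - f (X (Suc i), d)) * (LINT z|lebesgue. indicator ({..X i} \<times> {..d}) z * h z))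
    + (\<Sum>j<n. (f (b, Y j) - f (b, Y (Suc j))) * (LINT z|lebesgue. indicator ({..b} \<times> {..Y j}) z * h z))
    + (\<Sum>j<n. \<Sum>i<n. (f (X i, Y j) - f (X i, Y (Suc j)) - f (X (Suc i), Y j) + f (X (Suc i), Y (Suc j)))
        * (LINT z|lebesgue. indicator ({..X i} \<times> {..Y j}) z * h z))"
    unfolding expand using h int by simp
  also have "\<dots> \<ge> f (b, d) * (LINT z|lebesgue. h z)"
  proof -
    have "0 \<le> (\<Sum>i<n. (f (X i, d) - f (X (Suc i), d)) * (LINT z|lebesgue. indicator ({..X i} \<times> {..d}) z * h z))"
      by (intro sum_nonneg mult_nonneg_nonneg D1 V Xi d) auto
    moreover have "0 \<le> (\<Sum>j<n. (f (b, Y j) - f (b, Y (Suc j))) * (LINT z|lebesgue. indicator ({..b} \<times> {..Y j}) z * h z))"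
      by (intro sum_nonneg mult_nonneg_nonneg D2 V Yi b) auto
    moreover have "0 \<le> (\<Sum>j<n. \<Sum>i<n. (f (X i, Y j) - f (X i, Y (Suc j)) - f (X (Suc i), Y j) + f (X (Suc i), Y (Suc j)))
        * (LINT z|lebesgue. indicator ({..X i} \<times> {..Y j}) z * h z))"
      by (intro sum_nonneg mult_nonneg_nonneg D12 V Xi Yi) auto
    ultimately show ?thesis by linarith
  qed
  finally show "f (b, d) * (LINT z|lebesgue. h z) \<le> (LINT z|lebesgue. rect_step f X Y n z * h z)" .
qed

section \<open>Uniform grids: convergence and boundedness of the step functions\<close>

text \<open>The index is not capped at \<open>n\<close>, which keeps the grid monotone on all
  naturals; for \<open>n = 0\<close> division by zero makes it constantly \<open>a\<close>.\<close>

definition grid :: "real \<Rightarrow> real \<Rightarrow> nat \<Rightarrow> nat \<Rightarrow> real"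
  where "grid a b n i = a + real i * ((b - a) / real n)"

lemma grid_0: "grid a b n 0 = a"
  and grid_last: "n > 0 \<Longrightarrow> grid a b n n = b"
  by (simp_all add: grid_def)

lemma mono_grid: "a \<le> b \<Longrightarrow> mono (grid a b n)"
  by (intro monoI) (simp add: grid_def mult_right_mono divide_right_mono)

lemma grid_in: "a \<le> b \<Longrightarrow> n > 0 \<Longrightarrow> i \<le> n \<Longrightarrow> grid a b n i \<in> {a..b}"
  using monoD[OF mono_grid, of a b 0 i n] monoD[OF mono_grid, of a b i n n]
  by (simp add: grid_0 grid_last)

text \<open>For \<open>k > 0\<close> the point \<open>x\<close> lies in the cell ending at grid
  point \<open>k\<close>; for \<open>k = 0\<close> it is squeezed onto \<open>a\<close>.\<close>

lemma grid_close:
  assumes "a \<le> b" "a \<le> x" "x \<le> grid a b n k" "k = 0 \<or> grid a b n (k - 1) < x"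
  shows "\<bar>grid a b n k - x\<bar> \<le> (b - a) / real n"
proof (cases k)
  case 0
  with assms show ?thesis by (simp add: grid_0)
next
  case (Suc m)
  then have "grid a b n k = grid a b n (k - 1) + (b - a) / real n"
    by (simp add: grid_def distrib_right add_divide_distrib)
  with assms Suc show ?thesis by simp
qed

text \<open>The step function takes at \<open>z\<close> the value of \<open>f\<close> at a grid
  point within one mesh width of \<open>z\<close> in each coordinate, so continuity suffices. Using
  \<open>Suc n\<close> cells makes the grids reach \<open>b\<close> and \<open>d\<close>.\<close>

lemma rect_step_tendsto:
  assumes "a \<le> b" "c \<le> d" and f: "continuous_on ({a..b} \<times> {c..d}) f" and z: "z \<in> {a..b} \<times> {c..d}"
  shows "(\<lambda>n. rect_step f (grid a b (Suc n)) (grid c d (Suc n)) (Suc n) z) \<longlonglongrightarrow> f z"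
proof -
  obtain x y where xy: "z = (x, y)" "x \<in> {a..b}" "y \<in> {c..d}"
    using z by blast
  have "\<exists>p\<in>{a..b} \<times> {c..d}. rect_step f (grid a b (Suc n)) (grid c d (Suc n)) (Suc n) z = f p \<and>
      \<bar>fst p - x\<bar> \<le> (b - a) / real (Suc n) \<and> \<bar>snd p - y\<bar> \<le> (d - c) / real (Suc n)" for n
  proof -
    have "x \<le> grid a b (Suc n) (Suc n)" "y \<le> grid c d (Suc n) (Suc n)"
      using xy by (simp_all add: grid_last)
    then obtain k l where kl: "k \<le> Suc n" "x \<le> grid a b (Suc n) k" "k = 0 \<or> grid a b (Suc n) (k - 1) < x"
      "l \<le> Suc n" "y \<le> grid c d (Suc n) l" "l = 0 \<or> grid c d (Suc n) (l - 1) < y"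
      "rect_step f (grid a b (Suc n)) (grid c d (Suc n)) (Suc n) (x, y) = f (grid a b (Suc n) k, grid c d (Suc n) l)"
      using rect_step_eq[OF mono_grid[OF assms(1)] mono_grid[OF assms(2)]] by metis
    show ?thesis
      using kl xy assms(1,2) grid_in[OF assms(1) _ kl(1)] grid_in[OF assms(2) _ kl(4)]
        grid_close[OF assms(1) _ kl(2,3)] grid_close[OF assms(2) _ kl(5,6)]
      by (intro bexI[of _ "(grid a b (Suc n) k, grid c d (Suc n) l)"]) auto
  qed
  then obtain p where p: "p n \<in> {a..b} \<times> {c..d}"
      "rect_step f (grid a b (Suc n)) (grid c d (Suc n)) (Suc n) z = f (p n)"
      "\<bar>fst (p n) - x\<bar> \<le> (b - a) / real (Suc n)" "\<bar>snd (p n) - y\<bar> \<le> (d - c) / real (Suc n)" for n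
    by metis
  have null: "(\<lambda>n. C / real (Suc n)) \<longlonglongrightarrow> 0" for C
    using LIMSEQ_Suc[OF lim_const_over_n] .
  have "(\<lambda>n. fst (p n) - x) \<longlonglongrightarrow> 0"
    by (rule Lim_null_comparison[OF _ null[of "b - a"]]) (use p(3) in auto)
  moreover have "(\<lambda>n. snd (p n) - y) \<longlonglongrightarrow> 0"
    by (rule Lim_null_comparison[OF _ null[of "d - c"]]) (use p(4) in auto)
  ultimately have "(\<lambda>n. (fst (p n), snd (p n))) \<longlonglongrightarrow> (x, y)"
    by (intro tendsto_Pair) (simp_all add: LIM_zero_cancel)
  then have "p \<longlonglongrightarrow> z"
    by (simp add: xy)
  then have "(\<lambda>n. f (p n)) \<longlonglongrightarrow> f z"
    by (rule continuous_on_tendsto_compose[OF f _ z]) (use p(1) in auto)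
  then show ?thesis
    by (simp add: p(2))
qed

text \<open>Only values of \<open>f\<close> at grid points occur, so the bound is independent of
  \<open>n\<close>, as dominated convergence requires.\<close>

lemma rect_step_bounded:
  assumes "a \<le> b" "c \<le> d" "n > 0" and B: "\<And>z. z \<in> {a..b} \<times> {c..d} \<Longrightarrow> \<bar>f z\<bar> \<le> B"
    and z: "z \<in> {a..b} \<times> {c..d}"
  shows "\<bar>rect_step f (grid a b n) (grid c d n) n z\<bar> \<le> B"
proof -
  obtain x y where xy: "z = (x, y)" "x \<in> {a..b}" "y \<in> {c..d}"
    using z by blast
  then have "x \<le> grid a b n n" "y \<le> grid c d n n"
    using assms(3) by (simp_all add: grid_last)
  then obtain k l where "k \<le> n" "l \<le> n"
    "rect_step f (grid a b n) (grid c d n) n (x, y) = f (grid a b n k, grid c d n l)"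
    using rect_step_eq[OF mono_grid[OF assms(1)] mono_grid[OF assms(2)]] by metis
  with assms(1-3) show ?thesis
    by (auto simp: xy intro!: B dest: grid_in[of _ _ n])
qed

section \<open>Passage to the limit in the weighted integral\<close>

theorem theorem2:
  fixes a b c d :: real and f w :: "real \<times> real \<Rightarrow> real"
  assumes "a \<le> b" and "c \<le> d"
    and "f continuously_differentiable_on ({a..b} \<times> {c..d})"
    and "two_d_monotone_decreasing {a..b} {c..d} f"
    and "set_integrable lebesgue ({a..b} \<times> {c..d}) w"
    and "\<And>x y. x \<in> {a..b} \<Longrightarrow> y \<in> {c..d} \<Longrightarrow> double_primitive a c w x y \<ge> 0"
  shows "(LINT x:{a..b}|lebesgue. (LINT y:{c..d}|lebesgue. f (x, y) * w (x, y)))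
           \<ge> f (b, d) * double_primitive a c w b d"
proof -
  define R where "R = {a..b} \<times> {c..d}"
  define h where "h = (\<lambda>z. indicator R z * w z)"
  have h: "integrable lebesgue h"
    using assms(5) by (simp add: set_integrable_def h_def R_def)
  obtain f' where "\<And>z. z \<in> R \<Longrightarrow> (f has_derivative blinfun_apply (f' z)) (at z within R)"
    using assms(3) unfolding continuously_differentiable_on_def R_def by blast
  \<comment> \<open>Continuity on the compact \<open>R\<close> supplies the bound \<open>B\<close>,
    the measurability of \<open>f z * h z\<close> and the pointwise limit.\<close>
  then have cont: "continuous_on R f"
    by (rule has_derivative_continuous_on)
  obtain B where B: "\<And>z. z \<in> R \<Longrightarrow> \<bar>f z\<bar> \<le> B"
    using compact_imp_bounded[OF compact_continuous_image[OF cont]]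
    by (auto simp: R_def compact_Times bounded_iff)
  have R: "R \<in> sets borel"
    unfolding R_def by (intro borel_closed closed_Times) auto
  have W: "double_primitive a c w x y = (LINT z:{..x} \<times> {..y}|lebesgue. h z)"
    if "x \<in> {a..b}" "y \<in> {c..d}" for x y
  proof -
    have "set_integrable lebesgue ({a..x} \<times> {c..y}) w"
      by (rule set_integrable_subset[OF assms(5)]) (use that in \<open>auto simp: borel_Times sets_completionI_sets\<close>)
    then have "double_primitive a c w x y = (LINT z:{a..x} \<times> {c..y}|lebesgue. w z)"
      unfolding double_primitive_def by (rule iterated_set_integral_lebesgue)
    \<comment> \<open>Within \<open>R\<close> the quadrant at \<open>(x, y)\<close> cuts out exactly
      \<open>{a..x} \<times> {c..y}\<close>, and \<open>h\<close> vanishes outside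
      \<open>R\<close>.\<close>
    also have "\<dots> = (LINT z:{..x} \<times> {..y}|lebesgue. h z)"
      unfolding set_lebesgue_integral_def
      by (rule Bochner_Integration.integral_cong) (use that in \<open>auto simp: h_def R_def indicator_def\<close>)
    finally show ?thesis .
  qed
  let ?s = "\<lambda>n. rect_step f (grid a b (Suc n)) (grid c d (Suc n)) (Suc n)"
  have step: "integrable lebesgue (\<lambda>z. ?s n z * h z)"
    "f (b, d) * (LINT z|lebesgue. h z) \<le> (LINT z|lebesgue. ?s n z * h z)" for n
    by (rule rect_step_integral_ge[OF mono_grid grid_0 grid_last mono_grid grid_0 grid_last assms(4) h];
        use assms W in auto)+
  \<comment> \<open>Nothing is known about \<open>f\<close> off \<open>R\<close>, so it is cut off
    there; the product with \<open>h\<close> does not change.\<close>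
  have "(\<lambda>z. indicator R z *\<^sub>R f z) \<in> borel_measurable lebesgue"
    using borel_measurable_continuous_on_indicator[OF R cont] by (intro measurable_completion) simp
  then have "(\<lambda>z. (indicator R z *\<^sub>R f z) * h z) \<in> borel_measurable lebesgue"
    using h by (intro borel_measurable_times) auto
  also have "(\<lambda>z. (indicator R z *\<^sub>R f z) * h z) = (\<lambda>z. f z * h z)"
    by (auto simp: h_def indicator_def)
  finally have fh: "(\<lambda>z. f z * h z) \<in> borel_measurable lebesgue" .
  \<comment> \<open>The bound and the limit hold at every point: off \<open>R\<close> the factor
    \<open>h z\<close> is zero.\<close>
  have bound: "AE z in lebesgue. norm (?s n z * h z) \<le> B * norm (h z)" for n
    using rect_step_bounded[OF assms(1,2), of "Suc n" f B] B
    by (intro AE_I2) (auto simp: abs_mult h_def R_def indicator_def intro!: mult_right_mono)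
  have lim: "AE z in lebesgue. (\<lambda>n. ?s n z * h z) \<longlonglongrightarrow> f z * h z"
    using rect_step_tendsto[OF assms(1,2) cont[unfolded R_def]]
    by (intro AE_I2) (auto simp: h_def R_def indicator_def intro!: tendsto_mult_right)
  have "(\<lambda>n. LINT z|lebesgue. ?s n z * h z) \<longlonglongrightarrow> (LINT z|lebesgue. f z * h z)"
    by (rule integral_dominated_convergence[where w = "\<lambda>z. B * norm (h z)"])
       (use fh step(1) h lim bound in auto)
  then have ge: "f (b, d) * (LINT z|lebesgue. h z) \<le> (LINT z|lebesgue. f z * h z)"
    by (rule LIMSEQ_le_const) (use step(2) in auto)
  \<comment> \<open>The same domination gives the integrability that Fubini requires for
    \<open>f z * w z\<close> on the rectangle.\<close>
  have "integrable lebesgue (\<lambda>z. f z * h z)"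
    by (rule integrable_dominated_convergence[where w = "\<lambda>z. B * norm (h z)" and s = "\<lambda>n z. ?s n z * h z"])
       (use fh step(1) h lim bound in auto)
  then have "set_integrable lebesgue ({a..b} \<times> {c..d}) (\<lambda>z. f z * w z)"
    by (simp add: set_integrable_def h_def R_def ac_simps)
  from iterated_set_integral_lebesgue[OF this]
  have "(LINT x:{a..b}|lebesgue. (LINT y:{c..d}|lebesgue. f (x, y) * w (x, y))) = (LINT z|lebesgue. f z * h z)"
    by (simp add: set_lebesgue_integral_def h_def R_def ac_simps)
  moreover have "double_primitive a c w b d = (LINT z|lebesgue. h z)"
    using W[of b d] assms(1,2) unfolding set_lebesgue_integral_def
    by (auto intro!: Bochner_Integration.integral_cong simp: h_def R_def indicator_def)
  ultimately show ?thesis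
    using ge by simp
qed

end
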